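(* Let $r$ be a function on $\mathbb R$ with Fourier transform $\widehat r$. Suppose both $r$ and $\widehat r$ are even functions in $L^1(\mathbb R)$ of bounded variation, and suppose $r(\alpha)$ has support in $|\alpha|\le1$. Assume AH-Density. Then \[ \sum_{k\in\mathbb Z}\widehat r(k/2)\,p_{k/2}=r(0)+2\int_0^1\alpha\, r(\alpha)\,d\alpha. \]
   Context: The Fourier transform is $\widehat r(t)=\int_{-\infty}^{\infty}r(\alpha)e(-t\alpha)\,d\alpha$, where $e(\theta)=e^{2\pi i\theta}$. Let $\gamma$ range over ordinates of nontrivial zeros of the Riemann zeta-function, counted with multiplicity. Fix $0<\delta\le1/2$. For $k\in\mathbb Z$, let $P_{k/2}(T)=\left(\frac T{2\pi}\log T\right)^{-1}N_k(T)$, where $N_k(T)$ is the number of pairs $(\gamma,\gamma')$, counted with multiplicity, with $T/\log^2T<\gamma,\gamma'\le T$ and $\frac k2-\frac\delta2<\frac{\gamma-\gamma'}{2\pi}\log T\le\frac k2+\frac\delta2$. Let $p_{k/2}=\lim_{T\to\infty}P_{k/2}(T)$. AH-Density is the hypothesis that all limits $p_{k/2}$ ($k\in\mathbb Z$) exist, that $1\le p_0\le\frac32-\frac2{\pi^2}$, and that \[ p_{k/2}=\begin{cases}p_0-\frac12,& k\neq0\text{ even},\\ \frac32-\frac2{\pi^2k^2}-p_0,& k\text{ odd}.\end{cases} \]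
   Formalization: r is additionally assumed continuous at 0; otherwise changing the single value r(0) leaves its Fourier transform and all the hypotheses intact but alters the right-hand side, so the identity would fail. *)

theory Defs
  imports "HOL-Complex_Analysis.Complex_Analysis"
begin

text \<open>
  The analytic continuation of the Dirichlet series to \<open>Re s > -1\<close>, which contains the critical
  strip, by first-order Euler--Maclaurin summation; the series sums the error of the trapezoidal
  rule for \<open>\<integral>\<^sub>1\<^sup>\<infinity> x powr (-s) dx\<close>. The lemmas \<open>holomorphic_riemann_zeta\<close> and
  \<open>riemann_zeta_sums\<close> identify it. Outside \<open>Re s > -1\<close>, and at the pole \<open>s = 1\<close>, the value is
  meaningless.
\<close>

definition zeta_term :: "nat \<Rightarrow> complex \<Rightarrow> complex" where
  "zeta_term n s =
     (of_nat (n+1) powr (-s) + of_nat (n+2) powr (-s)) / 2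
       - (of_nat (n+2) powr (1-s) - of_nat (n+1) powr (1-s)) / (1-s)"

definition riemann_zeta :: "complex \<Rightarrow> complex" where
  "riemann_zeta s = 1 / (s-1) + 1/2 + (\<Sum>n. zeta_term n s)"

lemma norm_zeta_term_le:
  assumes s: "s \<noteq> 1" "Re s > -1"
  shows "norm (zeta_term n s) \<le> norm s * norm (s+1) / 2 * real (n+1) powr (- Re s - 2)"
proof -
  define m :: complex where "m = of_nat (n+1)"
  define B where "B = norm s * norm (s+1) / 2 * real (n+1) powr (- Re s - 2)"
  define S where "S = closed_segment (0::complex) 1"
  define g where "g h = h/2 * (m powr (-s) + (m+h) powr (-s))
                          - ((m+h) powr (1-s) - m powr (1-s)) / (1-s)" for h
  define g1 where "g1 h = (m powr (-s) + (m+h) powr (-s)) / 2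
                          - s/2 * h * (m+h) powr (-s-1) - (m+h) powr (-s)" for h
  define g2 where "g2 h = s*(s+1)/2 * h * (m+h) powr (-s-2)" for h
  have S: "\<exists>t. h = of_real t \<and> 0 \<le> t \<and> t \<le> 1" if "h \<in> S" for h
    using that unfolding S_def closed_segment_def by (auto simp: scaleR_conv_of_real)
  have S_of_real: "of_real t \<in> S" if "0 \<le> t" "t \<le> 1" for t
    using that unfolding S_def closed_segment_def by (auto simp: scaleR_conv_of_real)
  have mh: "m + of_real t = of_real (real (n+1) + t)" for t
    by (simp add: m_def)
  have nz: "m + h \<notin> \<real>\<^sub>\<le>\<^sub>0" if h: "h \<in> S" for h
  proof -
    obtain t where t: "h = of_real t" "0 \<le> t" "t \<le> 1" using S[OF h] by blast
    show ?thesis unfolding t mh complex_nonpos_Reals_iff using t by auto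
  qed
  have dpow: "((\<lambda>h. (m+h) powr a) has_field_derivative a * (m+h) powr (a-1)) (at h within S)"
    if "h \<in> S" for h a
  proof -
    have "((\<lambda>h. (m+h) powr a) has_field_derivative (a * (m+h) powr (a-1)) * 1) (at h within S)"
      by (rule DERIV_chain2[where f = "\<lambda>z. z powr a" and g = "\<lambda>h. m + h",
            OF has_field_derivative_powr[OF nz[OF that]]])
         (auto intro!: derivative_eq_intros)
    thus ?thesis by simp
  qed
  have cancel: "((1-s) * x - 0) / (1-s) = x" for x using s by simp
  have d1: "(g has_field_derivative g1 h) (at h within S)" if h: "h \<in> S" for h
    unfolding g_def g1_def
    by (rule DERIV_cong[OF DERIV_diff[OF
          DERIV_mult[OF DERIV_cdivide[OF DERIV_ident] DERIV_add[OF DERIV_const dpow[OF h]]]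
          DERIV_cdivide[OF DERIV_diff[OF dpow[OF h] DERIV_const]]]])
       (subst cancel, simp add: add_divide_distrib algebra_simps)
  have d2: "(g1 has_field_derivative g2 h) (at h within S)" if h: "h \<in> S" for h
    unfolding g1_def g2_def
    by (rule DERIV_cong[OF DERIV_diff[OF DERIV_diff[OF
          DERIV_cdivide[OF DERIV_add[OF DERIV_const dpow[OF h]]]
          DERIV_mult[OF DERIV_cmult[OF DERIV_ident] dpow[OF h]]] dpow[OF h]]])
       (simp add: algebra_simps add_divide_distrib diff_divide_distrib)
  have b2: "norm (g2 h) \<le> B" if h: "h \<in> S" for h
  proof -
    obtain t where t: "h = of_real t" "0 \<le> t" "t \<le> 1" using S[OF h] by blast
    have "norm ((m+h) powr (-s-2)) = (real (n+1) + t) powr (- Re s - 2)"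
      unfolding t mh using t by (subst norm_powr_real_powr) auto
    also have "\<dots> \<le> real (n+1) powr (- Re s - 2)"
      using t s by (intro powr_mono2') auto
    finally have 1: "norm ((m+h) powr (-s-2)) \<le> real (n+1) powr (- Re s - 2)" .
    have 2: "norm h \<le> 1" using t by simp
    have "norm (g2 h) = norm s * norm (s+1) / 2 * (norm h * norm ((m+h) powr (-s-2)))"
      by (simp add: g2_def norm_mult norm_divide)
    also have "\<dots> \<le> norm s * norm (s+1) / 2 * (1 * real (n+1) powr (- Re s - 2))"
      by (intro mult_left_mono mult_mono 1 2) auto
    finally show ?thesis by (simp add: B_def)
  qed
  have conv: "convex S" unfolding S_def by simp
  have 01: "0 \<in> S" "1 \<in> S" by (auto simp: S_def)
  have b1: "norm (g1 h) \<le> B" if h: "h \<in> S" for h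
  proof -
    have "norm (g1 h - g1 0) \<le> B * norm (h - 0)"
      by (rule field_differentiable_bound[OF conv d2 b2]) (use h 01 in auto)
    moreover have "g1 0 = 0" by (simp add: g1_def)
    moreover have "norm h \<le> 1" using S[OF h] by auto
    moreover have "B \<ge> 0" by (simp add: B_def)
    ultimately show ?thesis using mult_left_le[of "norm h" B] by simp
  qed
  have "norm (g 1 - g 0) \<le> B * norm (1 - 0 :: complex)"
    by (rule field_differentiable_bound[OF conv d1 b1]) (use 01 in auto)
  moreover have "g 0 = 0" by (simp add: g_def)
  moreover have "g 1 = zeta_term n s"
    by (simp add: g_def zeta_term_def m_def add_ac)
  ultimately show ?thesis by (simp add: B_def)
qed

lemma summable_zeta_bound:
  assumes "\<sigma> > -1"
  shows "summable (\<lambda>n. c * real (n+1) powr (-\<sigma>-2))"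
proof -
  have "summable (\<lambda>n. real n powr (-\<sigma>-2))"
    using assms by (subst summable_real_powr_iff) auto
  hence "summable (\<lambda>n. real (n+1) powr (-\<sigma>-2))"
    by (subst summable_iff_shift)
  thus ?thesis by (rule summable_mult)
qed

lemma summable_zeta_term:
  assumes "s \<noteq> 1" "Re s > -1"
  shows "summable (\<lambda>n. zeta_term n s)"
  by (rule summable_comparison_test'[OF summable_zeta_bound[OF assms(2)]])
     (rule norm_zeta_term_le[OF assms])

lemma open_connected_zeta_domain:
  "open ({s. Re s > -1} - {1})" "connected ({s. Re s > -1} - {1::complex})"
proof -
  have o: "open {s. Re s > -1}" by (rule open_halfspace_Re_gt)
  thus "open ({s. Re s > -1} - {1})" by auto
  show "connected ({s. Re s > -1} - {1::complex})"
    by (rule connected_open_delete[OF o])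
       (auto intro!: convex_connected convex_halfspace_Re_gt)
qed

lemma holomorphic_riemann_zeta:
  "riemann_zeta holomorphic_on {s. Re s > -1} - {1}"
proof -
  let ?S = "{s. Re s > -1} - {1::complex}"
  have "(\<lambda>s. \<Sum>n. zeta_term n s) holomorphic_on ?S"
  proof (rule holomorphic_uniform_sequence[where f = "\<lambda>N s. \<Sum>n<N. zeta_term n s"])
    show "open ?S" by (rule open_connected_zeta_domain)
    show "(\<lambda>s. \<Sum>n<N. zeta_term n s) holomorphic_on ?S" for N
      unfolding zeta_term_def by (auto intro!: holomorphic_intros)
    fix x assume x: "x \<in> ?S"
    obtain d where d: "d > 0" "cball x d \<subseteq> ?S"
      using open_connected_zeta_domain(1) x open_contains_cball by blast
    have ne: "cball x d \<noteq> {}" using d by auto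
    have "continuous_on (cball x d) Re" by (intro continuous_intros)
    then obtain y where y: "y \<in> cball x d" "\<And>z. z \<in> cball x d \<Longrightarrow> Re y \<le> Re z"
      using continuous_attains_inf[OF compact_cball ne, of Re] by blast
    define R where "R = norm x + d"
    have R: "norm z \<le> R" if "z \<in> cball x d" for z
    proof -
      have "norm z \<le> norm x + norm (z - x)" using norm_triangle_ineq[of x "z-x"] by simp
      thus ?thesis using that by (simp add: R_def dist_norm norm_minus_commute)
    qed
    have "R \<ge> 0" using d by (simp add: R_def)
    have "uniform_limit (cball x d) (\<lambda>N s. \<Sum>n<N. zeta_term n s) (\<lambda>s. \<Sum>n. zeta_term n s) sequentially"
    proof (rule Weierstrass_m_test)
      show "summable (\<lambda>n. R * (R+1) / 2 * real (n+1) powr (- Re y - 2))"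
        using y(1) d(2) by (intro summable_zeta_bound) auto
      fix n z assume z: "z \<in> cball x d"
      have "norm (zeta_term n z) \<le> norm z * norm (z+1) / 2 * real (n+1) powr (- Re z - 2)"
        using z d(2) by (intro norm_zeta_term_le) auto
      also have "\<dots> \<le> R * (R+1) / 2 * real (n+1) powr (- Re y - 2)"
      proof (intro mult_mono divide_right_mono)
        show "norm (z+1) \<le> R + 1" using R[OF z] norm_triangle_ineq[of z 1] by simp
        show "real (n+1) powr (- Re z - 2) \<le> real (n+1) powr (- Re y - 2)"
          using y(2)[OF z] by (intro powr_mono) auto
      qed (use R[OF z] \<open>R \<ge> 0\<close> in auto)
      finally show "norm (zeta_term n z) \<le> R * (R+1) / 2 * real (n+1) powr (- Re y - 2)" .
    qed
    thus "\<exists>d>0. cball x d \<subseteq> ?S \<and>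
        uniform_limit (cball x d) (\<lambda>N s. \<Sum>n<N. zeta_term n s) (\<lambda>s. \<Sum>n. zeta_term n s) sequentially"
      using d by blast
  qed
  thus ?thesis unfolding riemann_zeta_def [abs_def] by (auto intro!: holomorphic_intros)
qed

lemma riemann_zeta_sums:
  assumes s: "Re s > 1"
  shows "(\<lambda>n. of_nat (n+1) powr (-s)) sums riemann_zeta s"
proof -
  have s1: "s \<noteq> 1" using s by auto
  define p where "p a N = (of_nat (N+1) :: complex) powr a" for a N
  have partial: "(\<Sum>n<N. zeta_term n s) =
      (\<Sum>n<N. p (-s) n) - 1/2 + p (-s) N / 2 - (p (1-s) N - 1) / (1-s)" for N
  proof (induction N)
    case (Suc N)
    have "(\<Sum>n<Suc N. zeta_term n s) = (\<Sum>n<N. zeta_term n s) + zeta_term N s" by simp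
    also have "zeta_term N s = (p (-s) N + p (-s) (Suc N)) / 2 - (p (1-s) (Suc N) - p (1-s) N) / (1-s)"
      by (simp add: zeta_term_def p_def)
    finally show ?case
      by (simp add: Suc.IH add_divide_distrib diff_divide_distrib)
  qed (simp add: p_def)
  have lim0: "(p a \<longlonglongrightarrow> 0)" if "Re a < 0" for a
  proof (rule tendsto_norm_zero_cancel)
    have "norm (p a N) = real (N+1) powr Re a" for N
      unfolding p_def using norm_powr_real_powr[of "real (N+1)" a] by simp
    moreover have "(\<lambda>N. real (N+1) powr Re a) \<longlonglongrightarrow> 0"
      by (rule tendsto_neg_powr[OF that])
         (rule filterlim_compose[OF filterlim_real_sequentially], rule filterlim_add_const_nat_at_top)
    ultimately show "(\<lambda>N. norm (p a N)) \<longlonglongrightarrow> 0" by simp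
  qed
  have "(\<lambda>N. \<Sum>n<N. zeta_term n s) \<longlonglongrightarrow> (\<Sum>n. zeta_term n s)"
    using summable_zeta_term[of s] s s1 by (intro summable_LIMSEQ) auto
  hence "(\<lambda>N. (\<Sum>n<N. zeta_term n s) + 1/2 - p (-s) N / 2 + (p (1-s) N - 1) / (1-s))
           \<longlonglongrightarrow> (\<Sum>n. zeta_term n s) + 1/2 - 0 / 2 + (0 - 1) / (1-s)"
    using s s1 by (intro tendsto_intros lim0) auto
  also have "(\<lambda>N. (\<Sum>n<N. zeta_term n s) + 1/2 - p (-s) N / 2 + (p (1-s) N - 1) / (1-s))
              = (\<lambda>N. \<Sum>n<N. p (-s) n)"
    by (simp add: partial)
  also have "(\<Sum>n. zeta_term n s) + 1/2 - 0 / 2 + (0 - 1) / (1-s) = riemann_zeta s"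
    using s1 by (simp add: riemann_zeta_def field_simps)
  finally show ?thesis by (simp add: sums_def p_def)
qed

definition nontrivial_zeros :: "complex set" where
  "nontrivial_zeros = {\<rho>. 0 < Re \<rho> \<and> Re \<rho> < 1 \<and> riemann_zeta \<rho> = 0}"

definition zero_mult :: "complex \<Rightarrow> nat" where
  "zero_mult \<rho> = nat (zorder riemann_zeta \<rho>)"

definition AH_pairs :: "real \<Rightarrow> int \<Rightarrow> real \<Rightarrow> (complex \<times> complex) set" where
  "AH_pairs \<delta> k T = {(\<rho>, \<rho>'). \<rho> \<in> nontrivial_zeros \<and> \<rho>' \<in> nontrivial_zeros \<and>
     T / (ln T)\<^sup>2 < Im \<rho> \<and> Im \<rho> \<le> T \<and> T / (ln T)\<^sup>2 < Im \<rho>' \<and> Im \<rho>' \<le> T \<and>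
     real_of_int k / 2 - \<delta> / 2 < (Im \<rho> - Im \<rho>') / (2 * pi) * ln T \<and>
     (Im \<rho> - Im \<rho>') / (2 * pi) * ln T \<le> real_of_int k / 2 + \<delta> / 2}"

text \<open>The finiteness lemma rules out the default value of sums over infinite sets.\<close>

lemma finite_AH_pairs:
  assumes "T > 1"
  shows "finite (AH_pairs \<delta> k T)"
proof -
  let ?S = "{s. Re s > -1} - {1::complex}"
  define a where "a = T / (ln T)\<^sup>2"
  define K where "K = cbox (Complex 0 a) (Complex 1 T)"
  have a: "a > 0" using assms by (simp add: a_def)
  have "riemann_zeta 2 \<noteq> 0"
  proof
    assume 0: "riemann_zeta 2 = 0"
    have "(\<lambda>n. Re (of_nat (n+1) powr (-2))) sums Re (riemann_zeta 2)"
      using riemann_zeta_sums[of 2] sums_Re by force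
    moreover have "Re (of_nat (n+1) powr (-2)) = real (n+1) powr (-2)" for n
      using powr_of_real[of "real (n+1)" "-2"] by (simp del: of_nat_add of_nat_Suc)
    ultimately have *: "(\<lambda>n. real (n+1) powr (-2)) sums 0" using 0 by simp
    have "(\<Sum>n. real (n+1) powr (-2)) > 0"
      by (rule suminf_pos2[of _ 0]) (use * in \<open>auto simp: sums_iff\<close>)
    thus False using * by (simp add: sums_iff)
  qed
  hence nc: "\<not> riemann_zeta constant_on ?S" if "z \<in> ?S" "riemann_zeta z = 0" for z
    using that unfolding constant_on_def by (force intro: exI[of _ 2])
  have sub: "K \<subseteq> ?S" using a by (auto simp: K_def in_cbox_complex_iff)
  have "finite {z \<in> K. riemann_zeta z = 0}"
  proof (cases "\<exists>z\<in>K. riemann_zeta z = 0")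
    case True
    then obtain z where "z \<in> ?S" "riemann_zeta z = 0" using sub by blast
    show ?thesis
      by (rule holomorphic_compact_finite_zeros[OF holomorphic_riemann_zeta
            open_connected_zeta_domain _ sub nc]) (use K_def \<open>z \<in> ?S\<close> \<open>riemann_zeta z = 0\<close> in auto)
  next
    case False
    hence "{z \<in> K. riemann_zeta z = 0} = {}" by blast
    thus ?thesis by (simp only: finite.emptyI)
  qed
  moreover have "AH_pairs \<delta> k T \<subseteq> {z \<in> K. riemann_zeta z = 0} \<times> {z \<in> K. riemann_zeta z = 0}"
    by (auto simp: AH_pairs_def nontrivial_zeros_def K_def in_cbox_complex_iff a_def)
  ultimately show ?thesis by (meson finite_SigmaI finite_subset)
qed

definition AH_count :: "real \<Rightarrow> int \<Rightarrow> real \<Rightarrow> nat" where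
  "AH_count \<delta> k T = (\<Sum>(\<rho>, \<rho>') \<in> AH_pairs \<delta> k T. zero_mult \<rho> * zero_mult \<rho>')"

text \<open>The integer \<open>k\<close> in the next two definitions stands for the subscript \<open>k/2\<close>.\<close>

definition AH_P :: "real \<Rightarrow> int \<Rightarrow> real \<Rightarrow> real" where
  "AH_P \<delta> k T = inverse (T / (2 * pi) * ln T) * real (AH_count \<delta> k T)"

definition AH_p :: "real \<Rightarrow> int \<Rightarrow> real" where
  "AH_p \<delta> k = Lim at_top (AH_P \<delta> k)"

definition AH_density :: "real \<Rightarrow> bool" where
  "AH_density \<delta> \<longleftrightarrow>
     (\<forall>k. \<exists>l. (AH_P \<delta> k \<longlongrightarrow> l) at_top) \<and>
     1 \<le> AH_p \<delta> 0 \<and> AH_p \<delta> 0 \<le> 3/2 - 2 / pi\<^sup>2 \<and>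
     (\<forall>k. k \<noteq> 0 \<longrightarrow> even k \<longrightarrow> AH_p \<delta> k = AH_p \<delta> 0 - 1/2) \<and>
     (\<forall>k. odd k \<longrightarrow> AH_p \<delta> k = 3/2 - 2 / (pi\<^sup>2 * (real_of_int k)\<^sup>2) - AH_p \<delta> 0)"

text \<open>
  Neither integrability nor bounded variation of \<open>r\<close> and its transform determines the single
  value \<open>r 0\<close>. Statements that recover \<open>r 0\<close> from \<open>fourier r\<close> therefore need \<open>r\<close> to be normalised
  there; for even \<open>r\<close> of bounded variation, having the mean of the one-sided limits as value at
  \<open>0\<close> is the same as \<open>isCont r 0\<close>.
\<close>

definition fourier :: "(real \<Rightarrow> complex) \<Rightarrow> real \<Rightarrow> complex" where
  "fourier r t = (LINT \<alpha>|lborel. r \<alpha> * exp (2 * of_real pi * \<i> * of_real (- t * \<alpha>)))"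

definition bounded_variation :: "(real \<Rightarrow> 'a::real_normed_vector) \<Rightarrow> bool" where
  "bounded_variation f \<longleftrightarrow>
     (\<exists>B. \<forall>x::nat \<Rightarrow> real. incseq x \<longrightarrow> (\<forall>n. (\<Sum>i<n. norm (f (x (Suc i)) - f (x i))) \<le> B))"

end

theory Submission
  imports Defs
begin

text \<open>
  Only the closed form of the densities matters. Writing \<open>p\<close> for \<open>AH_p \<delta> 0\<close>, the hypothesis says
  that the density at \<open>k/2\<close> is \<open>1/2 + (p - 1) (-1)\<^sup>k + [k = 0]/2 - [k odd] 2/(\<pi>\<^sup>2 k\<^sup>2)\<close>.
  Poisson summation evaluates the first two parts: \<open>fourier r (k/2)\<close> sums to \<open>2 r(0)\<close>, and to \<open>0\<close>
  with the signs \<open>(-1)\<^sup>k\<close>, whatever \<open>p\<close> is. The numbers \<open>4/(\<pi>\<^sup>2 k\<^sup>2)\<close> at odd \<open>k\<close> are the Fourier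
  coefficients of the tent function \<open>1/2 - \<bar>y\<bar>\<close> on \<open>[-1, 1]\<close>, so the last part integrates \<open>r\<close>
  against it.

  Both Fourier expansions come from Abel means with the Poisson kernel, which converge at every
  point of continuity; absolute convergence of the sampled series follows from integrability and
  bounded variation of \<open>fourier r\<close>.
\<close>

section \<open>Termwise integration of trigonometric series\<close>

lemma fourier_cis: "fourier f t = (LINT y|lborel. f y * cis (- 2 * pi * t * y))"
  by (simp add: fourier_def cis_conv_exp mult_ac)

lemma integrable_mult_cis:
  assumes "integrable lborel f"
  shows "integrable lborel (\<lambda>y. f y * cis (a * y))"
proof (rule Bochner_Integration.integrable_bound[OF assms])
  have "(\<lambda>y. cis (a * y)) \<in> borel_measurable borel"
    by (intro borel_measurable_continuous_onI continuous_intros)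
  then show "(\<lambda>y. f y * cis (a * y)) \<in> borel_measurable lborel"
    using assms by (intro borel_measurable_times) auto
qed (auto simp: norm_mult)

text \<open>Summation and integration may be interchanged because the terms are dominated by
  \<open>norm (w k) * norm (f y)\<close>. The expansion of \<open>W\<close> is asked for only almost
  everywhere and only where \<open>f\<close> is nonzero, which suits series whose sum is known off a
  null set and on the support of \<open>f\<close>.\<close>

lemma has_sum_fourier:
  fixes w :: "int \<Rightarrow> complex" and c :: "int \<Rightarrow> real"
  assumes f: "integrable lborel f"
    and w: "(\<lambda>k. norm (w k)) summable_on UNIV"
    and W: "W \<in> borel_measurable lborel"
    and sum: "AE y in lborel. f y \<noteq> 0 \<longrightarrow> ((\<lambda>k. w k * cis (- 2 * pi * c k * y)) has_sum W y) UNIV"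
  shows "((\<lambda>k. w k * fourier f (c k)) has_sum (LINT y|lborel. f y * W y)) UNIV"
proof -
  \<comment> \<open>The interchange theorem speaks of series over the naturals. Enumerating the
    integers loses nothing, since absolute summability makes the order immaterial.\<close>
  have bij: "bij_betw int_decode UNIV UNIV" by (rule bij_int_decode)
  define w' where "w' n = w (int_decode n)" for n
  define c' where "c' n = c (int_decode n)" for n
  define g where "g n y = w' n * (f y * cis (- 2 * pi * c' n * y))" for n y
  have "(\<lambda>n. norm (w' n)) summable_on UNIV"
    unfolding w'_def using w summable_on_reindex_bij_betw[OF bij, of "\<lambda>k. norm (w k)"] by simp
  then have w': "summable (\<lambda>n. norm (w' n))" by (rule summable_on_imp_summable)
  have norm_g: "norm (g n y) = norm (w' n) * norm (f y)" for n y
    by (simp add: g_def norm_mult)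
  have int_g: "integrable lborel (g n)" for n
    unfolding g_def by (intro integrable_mult_right integrable_mult_cis f)
  have fou: "(LINT y|lborel. g n y) = w' n * fourier f (c' n)" for n
    unfolding g_def fourier_cis by simp
  have summ: "AE y in lborel. summable (\<lambda>n. norm (g n y))"
    unfolding norm_g by (intro AE_I2 summable_mult2 w')
  have summ': "summable (\<lambda>n. LINT y|lborel. norm (g n y))"
    unfolding norm_g by (simp add: summable_mult2 w')
  have "(\<lambda>n. LINT y|lborel. g n y) sums (LINT y|lborel. (\<Sum>n. g n y))"
    by (rule sums_integral[OF int_g summ summ'])
  also have "(LINT y|lborel. (\<Sum>n. g n y)) = (LINT y|lborel. f y * W y)"
  proof (rule integral_cong_AE)
    show "(\<lambda>y. \<Sum>n. g n y) \<in> borel_measurable lborel"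
      using int_g by (intro borel_measurable_suminf) auto
    show "(\<lambda>y. f y * W y) \<in> borel_measurable lborel"
      using f W by (intro borel_measurable_times) auto
    show "AE y in lborel. (\<Sum>n. g n y) = f y * W y"
      using sum
    proof eventually_elim
      case (elim y)
      show ?case
      proof (cases "f y = 0")
        case False
        then have "((\<lambda>k. w k * cis (- 2 * pi * c k * y)) has_sum W y) UNIV" using elim by simp
        then have "((\<lambda>n. w' n * cis (- 2 * pi * c' n * y)) has_sum W y) UNIV"
          unfolding w'_def c'_def
          using has_sum_reindex_bij_betw[OF bij, of "\<lambda>k. w k * cis (- 2 * pi * c k * y)"] by simp
        then have "(\<lambda>n. w' n * cis (- 2 * pi * c' n * y)) sums W y" by (rule has_sum_imp_sums)
        then have "(\<lambda>n. f y * (w' n * cis (- 2 * pi * c' n * y))) sums (f y * W y)"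
          by (rule sums_mult)
        then show ?thesis by (simp add: g_def sums_iff mult_ac)
      qed (simp add: g_def)
    qed
  qed
  finally have "(\<lambda>n. w' n * fourier f (c' n)) sums (LINT y|lborel. f y * W y)"
    unfolding fou .
  moreover have "summable (\<lambda>n. norm (w' n * fourier f (c' n)))"
  proof (rule summable_comparison_test'[OF summ'])
    show "norm (norm (w' n * fourier f (c' n))) \<le> (LINT y|lborel. norm (g n y))" for n
      unfolding fou[symmetric] by simp
  qed
  ultimately have "((\<lambda>n. w' n * fourier f (c' n)) has_sum (LINT y|lborel. f y * W y)) UNIV"
    by (intro norm_summable_imp_has_sum)
  then show ?thesis
    unfolding w'_def c'_def
    using has_sum_reindex_bij_betw[OF bij, of "\<lambda>k. w k * fourier f (c k)"] by simp
qed

section \<open>The Poisson kernel and its expansion\<close>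

definition poisson_kernel :: "real \<Rightarrow> real \<Rightarrow> real" where
  "poisson_kernel \<rho> \<theta> = (1 - \<rho>\<^sup>2) / (1 - 2 * \<rho> * cos \<theta> + \<rho>\<^sup>2)"

text \<open>This form shows positivity for \<open>0 \<le> \<rho> < 1\<close> and gives two lower
  bounds: \<open>(1 - \<rho>)\<^sup>2\<close> everywhere, and
  \<open>2 * \<rho> * (1 - cos \<theta>)\<close>, which stays away from \<open>0\<close> as \<rho>
  tends to 1 when \<open>cos \<theta>\<close> is bounded away from 1.\<close>

lemma poisson_denom:
  fixes \<rho> \<theta> :: real
  shows "1 - 2 * \<rho> * cos \<theta> + \<rho>\<^sup>2 = (1 - \<rho>)\<^sup>2 + 2 * \<rho> * (1 - cos \<theta>)"
  by (simp add: power2_eq_square algebra_simps)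

lemma poisson_denom_pos:
  fixes \<rho> \<theta> :: real
  assumes "0 \<le> \<rho>" "\<rho> < 1"
  shows "1 - 2 * \<rho> * cos \<theta> + \<rho>\<^sup>2 > 0"
  unfolding poisson_denom using assms by (intro add_pos_nonneg) auto

lemma poisson_kernel_nonneg: "0 \<le> \<rho> \<Longrightarrow> \<rho> < 1 \<Longrightarrow> poisson_kernel \<rho> \<theta> \<ge> 0"
  unfolding poisson_kernel_def
  by (intro divide_nonneg_pos poisson_denom_pos) (auto simp: power_le_one)

lemma has_sum_geometric_nat:
  fixes z :: complex
  assumes "norm z < 1"
  shows "((\<lambda>n. z ^ n) has_sum (1 / (1 - z))) UNIV"
  by (rule norm_summable_imp_has_sum)
     (use assms geometric_sums[of z] in \<open>auto simp: norm_power intro!: summable_geometric\<close>)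

lemma UNIV_int_split: "(UNIV :: int set) = range int \<union> range (\<lambda>n. - int (Suc n))"
proof -
  have "k \<in> range int \<union> range (\<lambda>n. - int (Suc n))" for k :: int
    by (cases k rule: int_cases) auto
  then show ?thesis by blast
qed

text \<open>For \<open>z = \<rho> * cis \<theta>\<close> the nonnegative indices form the geometric
  series of \<open>z\<close>, the negative ones that of \<open>cnj z\<close> starting at the first
  power. The two fractions combine to \<open>(1 - |z|^2) / |1 - z|^2\<close>.\<close>

lemma has_sum_poisson_kernel:
  fixes \<rho> \<theta> :: real
  assumes \<rho>: "0 \<le> \<rho>" "\<rho> < 1"
  shows "((\<lambda>k::int. of_real (\<rho> ^ nat \<bar>k\<bar>) * cis (k * \<theta>)) has_sum of_real (poisson_kernel \<rho> \<theta>)) UNIV"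
proof -
  let ?f = "\<lambda>k::int. of_real (\<rho> ^ nat \<bar>k\<bar>) * cis (k * \<theta>)"
  define z where "z = of_real \<rho> * cis \<theta>"
  have nz: "norm z < 1" "norm (cnj z) < 1" using \<rho> by (auto simp: z_def norm_mult)
  have ne: "1 - z \<noteq> 0" "1 - cnj z \<noteq> 0" using nz by auto
  have "((\<lambda>n. z ^ n) has_sum (1 / (1 - z))) UNIV" by (rule has_sum_geometric_nat[OF nz(1)])
  also have "(\<lambda>n. z ^ n) = ?f \<circ> int"
    by (auto simp: fun_eq_iff z_def power_mult_distrib Complex.DeMoivre)
  finally have 1: "(?f has_sum (1 / (1 - z))) (range int)"
    by (simp only: has_sum_reindex[OF inj_of_nat])
  have "((\<lambda>n. cnj z * cnj z ^ n) has_sum (cnj z * (1 / (1 - cnj z)))) UNIV"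
    by (intro has_sum_cmult_right has_sum_geometric_nat nz)
  also have "(\<lambda>n. cnj z * cnj z ^ n) = ?f \<circ> (\<lambda>n. - int (Suc n))"
  proof
    fix n
    have "cnj z * cnj z ^ n = of_real (\<rho> ^ Suc n) * cis (- \<theta>) ^ Suc n"
      by (simp add: z_def power_mult_distrib cis_cnj)
    also have "cis (- \<theta>) ^ Suc n = cis (real (Suc n) * (- \<theta>))" by (rule Complex.DeMoivre)
    also have "\<dots> = cis (real_of_int (- int (Suc n)) * \<theta>)" by (simp add: algebra_simps)
    finally show "cnj z * cnj z ^ n = (?f \<circ> (\<lambda>n. - int (Suc n))) n"
      by (simp add: nat_add_distrib del: power_Suc) 
  qed
  finally have 2: "(?f has_sum (cnj z * (1 / (1 - cnj z)))) (range (\<lambda>n. - int (Suc n)))"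
    by (subst has_sum_reindex) (simp only: inj_on_def of_nat_eq_iff neg_equal_iff_equal nat.inject ball_UNIV simp_thms)
  have "(?f has_sum (1 / (1 - z) + cnj z * (1 / (1 - cnj z)))) UNIV"
    unfolding UNIV_int_split by (intro has_sum_Un_disjoint 1 2) auto
  also have "1 / (1 - z) + cnj z * (1 / (1 - cnj z)) = (1 - z * cnj z) / ((1 - z) * (1 - cnj z))"
    using ne by (simp add: field_simps)
  also have "z * cnj z = of_real (\<rho>\<^sup>2)"
    using \<rho> by (subst complex_norm_square[symmetric]) (simp add: z_def norm_mult)
  also have "(1 - z) * (1 - cnj z) = of_real (1 - 2 * \<rho> * cos \<theta> + \<rho>\<^sup>2)"
  proof -
    have "(1 - z) * (1 - cnj z) = 1 - (z + cnj z) + z * cnj z" by (simp add: algebra_simps)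
    also have "z * cnj z = of_real (\<rho>\<^sup>2)"
      using \<rho> by (subst complex_norm_square[symmetric]) (simp add: z_def norm_mult)
    also have "z + cnj z = of_real (2 * \<rho> * cos \<theta>)"
      by (simp add: complex_eq_iff z_def)
    finally show ?thesis by simp
  qed
  finally show ?thesis by (simp add: poisson_kernel_def)
qed

lemma summable_on_power_nat_abs:
  assumes \<rho>: "0 \<le> \<rho>" "\<rho> < (1::real)"
  shows "(\<lambda>k::int. \<rho> ^ nat \<bar>k\<bar>) summable_on UNIV"
proof -
  have "(\<lambda>k::int. complex_of_real (\<rho> ^ nat \<bar>k\<bar>)) summable_on UNIV"
    using has_sum_poisson_kernel[OF \<rho>, of 0] by (auto simp: summable_on_def)
  then have "(\<lambda>k::int. Re (complex_of_real (\<rho> ^ nat \<bar>k\<bar>))) summable_on UNIV"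
    by (rule summable_on_Re)
  then show ?thesis by simp
qed

section \<open>Abel means of Fourier series as Poisson integrals\<close>

lemma cis_eq_exp: "cis (- 2 * pi * t * y) = exp (- 2 * of_real pi * \<i> * of_real t * of_real y)"
  by (simp add: cis_conv_exp mult_ac)

lemma cis_pi_int: "cis (pi * of_int k) = (if even k then 1 else -1)"
  by (auto simp: complex_eq_iff cos_npi_int sin_npi_int)

lemma exp_pi_int: "exp (of_real pi * \<i> * of_int k) = (if even k then 1 else -1)"
  using cis_pi_int[of k] by (simp add: cis_conv_exp mult_ac)

lemma exp_minus_pi_int: "exp (- (of_real pi * \<i> * of_int k)) = (if even k then 1 else -1)"
  using exp_pi_int[of "-k"] by simp

text \<open>Orthogonality of the characters of period \<open>P\<close>: these are the Fourier
  coefficients of the constant 1 over one period.\<close>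

lemma fourier_indicator:
  assumes "P > 0"
  shows "fourier (indicator {-P/2..P/2}) (of_int k / P) = (if k = 0 then of_real P else 0)"
proof -
  define c :: complex where "c = - 2 * of_real pi * \<i> * of_real (k / P)"
  have c: "c = 0 \<longleftrightarrow> k = 0" using assms by (auto simp: c_def)
  \<comment> \<open>An antiderivative of \<open>exp (c * z)\<close>; for \<open>k = 0\<close> the
    exponent \<open>c\<close> vanishes and the integrand is constant.\<close>
  define F where "F z = (if k = 0 then z else exp (c * z) / c)" for z
  have "fourier (indicator {-P/2..P/2}) (of_int k / P)
      = (LINT y|lborel. indicator {-P/2..P/2} y *\<^sub>R exp (c * of_real y))"
    unfolding fourier_cis cis_eq_exp c_def
    by (intro Bochner_Integration.integral_cong) (auto split: split_indicator)
  also have "\<dots> = F (of_real (P/2)) - F (of_real (-P/2))"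
  proof (rule integral_FTC_Icc)
    show "((\<lambda>y. F (of_real y)) has_vector_derivative exp (c * of_real y)) (at y within {-P/2..P/2})" for y
      unfolding F_def using c
      by (intro has_vector_derivative_real_field) (auto intro!: derivative_eq_intros)
  qed (use assms in \<open>auto intro!: continuous_intros\<close>)
  also have "\<dots> = (if k = 0 then of_real P else 0)"
  proof (cases "k = 0")
    case False
    have "c * of_real (P/2) = - (of_real pi * \<i> * of_int k)" "c * of_real (-P/2) = of_real pi * \<i> * of_int k"
      using assms by (auto simp: c_def)
    then show ?thesis using False by (simp only: F_def exp_pi_int exp_minus_pi_int) simp
  qed (auto simp: F_def)
  finally show ?thesis .
qed

text \<open>The damping factor \<open>\<rho> ^ nat \<bar>k\<bar>\<close> makes the weights
  absolutely summable whatever \<open>f\<close> is, and the damped characters add up to the Poisson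
  kernel at the angle of \<open>x - y\<close>.\<close>

lemma has_sum_poisson_fourier:
  assumes "integrable lborel f" "0 \<le> \<rho>" "\<rho> < 1"
  shows "((\<lambda>k. of_real (\<rho> ^ nat \<bar>k\<bar>) * cis (2 * pi * k * x / P) * fourier f (of_int k / P)) has_sum
           (LINT y|lborel. f y * of_real (poisson_kernel \<rho> (2 * pi * (x - y) / P)))) UNIV"
proof (rule has_sum_fourier[OF assms(1)])
  show "(\<lambda>k. norm (of_real (\<rho> ^ nat \<bar>k\<bar>) * cis (2 * pi * k * x / P))) summable_on UNIV"
    using summable_on_power_nat_abs[OF assms(2,3)] assms by (simp add: norm_mult norm_power)
  show "(\<lambda>y. complex_of_real (poisson_kernel \<rho> (2 * pi * (x - y) / P))) \<in> borel_measurable lborel"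
    unfolding poisson_kernel_def by measurable
  have eq: "of_real (\<rho> ^ nat \<bar>k\<bar>) * cis (2 * pi * k * x / P) * cis (- 2 * pi * (k / P) * y)
      = of_real (\<rho> ^ nat \<bar>k\<bar>) * cis (k * (2 * pi * (x - y) / P))" for k y
  proof -
    have "2 * pi * k * x / P + - 2 * pi * (k / P) * y = k * (2 * pi * (x - y) / P)"
      by (simp add: algebra_simps diff_divide_distrib)
    then show ?thesis by (simp only: mult.assoc cis_mult)
  qed
  show "AE y in lborel. f y \<noteq> 0 \<longrightarrow>
      ((\<lambda>k. of_real (\<rho> ^ nat \<bar>k\<bar>) * cis (2 * pi * k * x / P) * cis (- 2 * pi * (k / P) * y)) has_sum
        of_real (poisson_kernel \<rho> (2 * pi * (x - y) / P))) UNIV"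
    unfolding eq using has_sum_poisson_kernel[OF assms(2,3)] by (intro AE_I2 impI)
qed

text \<open>The preceding expansion applied to the indicator of one period: by orthogonality only
  the term \<open>k = 0\<close>, equal to \<open>P\<close>, survives.\<close>

lemma integral_poisson_kernel:
  assumes "P > 0" "0 \<le> \<rho>" "\<rho> < 1"
  shows "(LINT y|lborel. indicator {-P/2..P/2} y * poisson_kernel \<rho> (2 * pi * (x - y) / P)) = P"
proof -
  let ?I = "indicator {-P/2..P/2} :: real \<Rightarrow> complex"
  have "integrable lborel (\<lambda>y. complex_of_real (indicator {-P/2..P/2} y))"
    by (intro integrable_of_real integrable_real_indicator) (auto simp: emeasure_lborel_Icc_eq)
  also have "(\<lambda>y. complex_of_real (indicator {-P/2..P/2} y)) = ?I"
    by (auto simp: fun_eq_iff split: split_indicator)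
  finally have int: "integrable lborel ?I" .
  have "((\<lambda>k. of_real (\<rho> ^ nat \<bar>k\<bar>) * cis (2 * pi * k * x / P) * fourier ?I (of_int k / P)) has_sum
           (LINT y|lborel. ?I y * of_real (poisson_kernel \<rho> (2 * pi * (x - y) / P)))) UNIV"
    by (rule has_sum_poisson_fourier[OF int assms(2,3)])
  moreover have "((\<lambda>k. of_real (\<rho> ^ nat \<bar>k\<bar>) * cis (2 * pi * k * x / P) * fourier ?I (of_int k / P)) has_sum
           of_real P) UNIV"
    by (rule has_sum_finite_neutralI[of "{0}"]) (use fourier_indicator[OF assms(1)] fourier_indicator[OF assms(1), of 0] in auto)
  ultimately have "(LINT y|lborel. ?I y * of_real (poisson_kernel \<rho> (2 * pi * (x - y) / P))) = of_real P"
    by (rule has_sum_unique)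
  also have "(\<lambda>y. ?I y * of_real (poisson_kernel \<rho> (2 * pi * (x - y) / P))) =
      (\<lambda>y. of_real (indicator {-P/2..P/2} y * poisson_kernel \<rho> (2 * pi * (x - y) / P)))"
    by (auto simp: fun_eq_iff split: split_indicator)
  finally show ?thesis by (simp only: integral_complex_of_real of_real_eq_iff)
qed

section \<open>Convergence of Fourier series at points of continuity\<close>

lemma cos_bound_off_center:
  fixes x P \<eta> :: real
  assumes "P > 0" "\<bar>x\<bar> < P/2" "\<eta> > 0"
  obtains C where "C < 1" "\<And>y. \<bar>y\<bar> \<le> P/2 \<Longrightarrow> \<bar>y - x\<bar> \<ge> \<eta> \<Longrightarrow> cos (2 * pi * (x - y) / P) \<le> C"
proof (cases "{y. \<bar>y\<bar> \<le> P/2 \<and> \<bar>y - x\<bar> \<ge> \<eta>} = {}")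
  case True
  then show ?thesis by (intro that[of 0]) auto
next
  case False
  let ?K = "{y. \<bar>y\<bar> \<le> P/2 \<and> \<bar>y - x\<bar> \<ge> \<eta>}"
  have "?K = {-P/2..P/2} \<inter> {y. \<bar>y - x\<bar> \<ge> \<eta>}" by auto
  moreover have "closed {y. \<bar>y - x\<bar> \<ge> \<eta>}"
    by (intro closed_Collect_le continuous_intros)
  ultimately have "compact ?K" by (simp add: compact_Int_closed)
  moreover have "continuous_on ?K (\<lambda>y. cos (2 * pi * (x - y) / P))"
    using assms by (intro continuous_intros) auto
  ultimately obtain z where z: "z \<in> ?K"
    "\<And>y. y \<in> ?K \<Longrightarrow> cos (2 * pi * (x - y) / P) \<le> cos (2 * pi * (x - z) / P)"
    using continuous_attains_sup[OF _ False] by blast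
  \<comment> \<open>The cosine is 1 only if \<open>x - z\<close> is a multiple of \<open>P\<close>.
    As \<open>\<bar>x\<bar> < P/2\<close> is strict, \<open>\<bar>x - z\<bar> < P\<close>, so the
    multiple is zero, against \<open>\<bar>z - x\<bar> \<ge> \<eta>\<close>.\<close>
  have "cos (2 * pi * (x - z) / P) \<noteq> 1"
  proof
    assume "cos (2 * pi * (x - z) / P) = 1"
    then obtain n :: int where "2 * pi * (x - z) / P = n * 2 * pi"
      using cos_one_2pi_int by auto
    then have "2 * pi * (x - z) = 2 * pi * (n * P)" using assms by (simp add: field_simps)
    then have n: "x - z = n * P" by simp
    have "\<bar>x - z\<bar> < P" using z(1) assms by auto
    then have "\<bar>real_of_int n\<bar> * P < 1 * P" unfolding n using assms by (simp add: abs_mult)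
    then have "\<bar>real_of_int n\<bar> < 1" using assms by simp
    then have "n = 0" by linarith
    then show False using n z(1) assms by auto
  qed
  then have "cos (2 * pi * (x - z) / P) < 1" using cos_le_one[of "2 * pi * (x - z) / P"] by linarith
  then show ?thesis using z(2) by (intro that) auto
qed

text \<open>Since \<open>2 * \<rho> \<ge> 1\<close>, the part
  \<open>2 * \<rho> * (1 - cos \<theta>)\<close> of the denominator is at least
  \<open>1 - C\<close>. The bound tends to 0 as \<rho> tends to 1, uniformly in such
  \<theta>.\<close>

lemma poisson_kernel_le:
  assumes "1/2 \<le> \<rho>" "\<rho> < 1" "cos \<theta> \<le> C" "C < 1"
  shows "poisson_kernel \<rho> \<theta> \<le> (1 - \<rho>\<^sup>2) / (1 - C)"
  unfolding poisson_kernel_def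
proof (rule divide_left_mono)
  have "1 * (1 - C) \<le> (2 * \<rho>) * (1 - cos \<theta>)" using assms by (intro mult_mono) auto
  then show "1 - C \<le> 1 - 2 * \<rho> * cos \<theta> + \<rho>\<^sup>2"
    unfolding poisson_denom by (smt (verit) zero_le_power2)
  show "0 \<le> 1 - \<rho>\<^sup>2" using assms by (simp add: power_le_one)
  show "0 < (1 - 2 * \<rho> * cos \<theta> + \<rho>\<^sup>2) * (1 - C)"
    using assms by (intro mult_pos_pos poisson_denom_pos) auto
qed

text \<open>The kernel is an approximate identity: it is nonnegative, has mass \<open>P\<close> over
  a period and tends to 0 uniformly away from the centre. Near \<open>x\<close> continuity makes
  \<open>f y - f x\<close> small; far from \<open>x\<close> the small kernel is integrated against
  the integrable function \<open>g\<close>, so \<open>f\<close> may be unbounded there.\<close>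

lemma poisson_integral_tendsto:
  fixes f :: "real \<Rightarrow> complex"
  assumes P: "P > 0" and f: "integrable lborel f"
    and supp: "\<And>y. f y \<noteq> 0 \<Longrightarrow> \<bar>y\<bar> \<le> P/2"
    and x: "\<bar>x\<bar> < P/2" and cont: "isCont f x"
  shows "((\<lambda>\<rho>. LINT y|lborel. f y * of_real (poisson_kernel \<rho> (2 * pi * (x - y) / P)))
           \<longlongrightarrow> of_real P * f x) (at_left 1)"
proof (rule tendstoI)
  fix \<epsilon> :: real assume \<epsilon>: "\<epsilon> > 0"
  let ?I = "indicator {-P/2..P/2} :: real \<Rightarrow> real"
  define K where "K \<rho> y = poisson_kernel \<rho> (2 * pi * (x - y) / P)" for \<rho> y
  \<comment> \<open>The kernel has mass \<open>P\<close>, so the part near \<open>x\<close>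
    contributes at most \<open>\<epsilon>' * P = \<epsilon> / 2\<close>.\<close>
  define \<epsilon>' where "\<epsilon>' = \<epsilon> / (2 * P)"
  have \<epsilon>': "\<epsilon>' > 0" using \<epsilon> P by (simp add: \<epsilon>'_def)
  obtain \<eta> where \<eta>: "\<eta> > 0" "\<And>y. \<bar>y - x\<bar> < \<eta> \<Longrightarrow> norm (f y - f x) < \<epsilon>'"
    using cont \<epsilon>' unfolding continuous_at_eps_delta by (auto simp: dist_norm)
  obtain C where C: "C < 1"
    "\<And>y. \<bar>y\<bar> \<le> P/2 \<Longrightarrow> \<bar>y - x\<bar> \<ge> \<eta> \<Longrightarrow> cos (2 * pi * (x - y) / P) \<le> C"
    using cos_bound_off_center[OF P x \<eta>(1)] by blast
  define g where "g y = norm (?I y *\<^sub>R (f y - f x))" for y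
  have intI: "integrable lborel ?I"
    by (rule integrable_real_indicator) (auto simp: emeasure_lborel_Icc_eq)
  have int_fx: "integrable lborel (\<lambda>y. ?I y *\<^sub>R (f y - f x))"
  proof -
    have "(\<lambda>y. ?I y *\<^sub>R (f y - f x)) = (\<lambda>y. f y - ?I y *\<^sub>R f x)"
      using supp by (force simp: fun_eq_iff split: split_indicator)
    then show ?thesis using f intI by simp
  qed
  have int_g: "integrable lborel g" unfolding g_def by (rule integrable_norm[OF int_fx])
  define M where "M = (LINT y|lborel. g y)"
  have bound: "norm ((LINT y|lborel. f y * of_real (K \<rho> y)) - of_real P * f x)
      \<le> \<epsilon> / 2 + (1 - \<rho>\<^sup>2) / (1 - C) * M" if \<rho>: "1/2 < \<rho>" "\<rho> < 1" for \<rho>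
  proof -
    have K0: "K \<rho> y \<ge> 0" for y unfolding K_def using \<rho> by (intro poisson_kernel_nonneg) auto
    \<comment> \<open>This bound blows up as \<rho> tends to 1; for fixed \<rho> it gives
      integrability of products with the kernel.\<close>
    have K1: "K \<rho> y \<le> (1 - \<rho>\<^sup>2) / ((1 - \<rho>)\<^sup>2)" for y
      unfolding K_def poisson_kernel_def poisson_denom
      by (intro divide_left_mono) (use \<rho> in \<open>auto simp: power_le_one intro!: mult_pos_pos add_pos_nonneg\<close>)
    have Km: "(\<lambda>y. K \<rho> y) \<in> borel_measurable lborel"
      unfolding K_def poisson_kernel_def by measurable
    have Kint: "integrable lborel (\<lambda>y. h y * of_real (K \<rho> y))" if "integrable lborel h" for h :: "real \<Rightarrow> complex"
    proof (rule Bochner_Integration.integrable_bound)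
      show "integrable lborel (\<lambda>y. ((1 - \<rho>\<^sup>2) / ((1 - \<rho>)\<^sup>2)) *\<^sub>R h y)" using that by simp
      show "(\<lambda>y. h y * of_real (K \<rho> y)) \<in> borel_measurable lborel" using Km that by measurable
      show "AE y in lborel. norm (h y * of_real (K \<rho> y)) \<le> norm (((1 - \<rho>\<^sup>2) / ((1 - \<rho>)\<^sup>2)) *\<^sub>R h y)"
      proof (rule AE_I2)
        fix y
        have "norm (h y * of_real (K \<rho> y)) = K \<rho> y * norm (h y)" using K0 by (simp add: norm_mult)
        also have "\<dots> \<le> (1 - \<rho>\<^sup>2) / ((1 - \<rho>)\<^sup>2) * norm (h y)" by (intro mult_right_mono K1) auto
        also have "\<dots> \<le> norm (((1 - \<rho>\<^sup>2) / ((1 - \<rho>)\<^sup>2)) *\<^sub>R h y)"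
          unfolding norm_scaleR real_norm_def by (intro mult_right_mono abs_ge_self) auto
        finally show "norm (h y * of_real (K \<rho> y)) \<le> norm (((1 - \<rho>\<^sup>2) / ((1 - \<rho>)\<^sup>2)) *\<^sub>R h y)" .
      qed
    qed
    have IK: "(LINT y|lborel. ?I y * K \<rho> y) = P"
      unfolding K_def using integral_poisson_kernel[OF P] \<rho> by simp
    \<comment> \<open>The integral of a non-integrable function defaults to 0, so the nonzero value
      \<open>P\<close> forces integrability.\<close>
    have IKint: "integrable lborel (\<lambda>y. ?I y * K \<rho> y)"
      using IK P not_integrable_integral_eq by fastforce
    have cIKint: "integrable lborel (\<lambda>y. complex_of_real (?I y * K \<rho> y))"
      by (rule integrable_of_real[OF IKint])
    have cIK: "(LINT y|lborel. of_real (?I y * K \<rho> y)) = complex_of_real P"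
      by (simp only: integral_complex_of_real IK)
    have "(LINT y|lborel. f y * of_real (K \<rho> y)) - of_real P * f x
        = (LINT y|lborel. f y * of_real (K \<rho> y)) - (LINT y|lborel. of_real (?I y * K \<rho> y) * f x)"
      using cIK by (simp del: of_real_mult)
    also have "\<dots> = (LINT y|lborel. f y * of_real (K \<rho> y) - of_real (?I y * K \<rho> y) * f x)"
      by (intro Bochner_Integration.integral_diff[symmetric] Kint f integrable_mult_left cIKint)
    also have "\<dots> = (LINT y|lborel. (?I y *\<^sub>R (f y - f x)) * of_real (K \<rho> y))"
      using supp by (intro Bochner_Integration.integral_cong) (force split: split_indicator simp: algebra_simps)+
    finally have "norm ((LINT y|lborel. f y * of_real (K \<rho> y)) - of_real P * f x)
        = norm (LINT y|lborel. (?I y *\<^sub>R (f y - f x)) * of_real (K \<rho> y))" by simp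
    also have "\<dots> \<le> (LINT y|lborel. norm (?I y *\<^sub>R (f y - f x) * of_real (K \<rho> y)))"
      by (rule integral_norm_bound)
    also have "\<dots> \<le> (LINT y|lborel. \<epsilon>' * (?I y * K \<rho> y) + (1 - \<rho>\<^sup>2) / (1 - C) * g y)"
    proof (rule integral_mono)
      show "integrable lborel (\<lambda>y. \<epsilon>' * (?I y * K \<rho> y) + (1 - \<rho>\<^sup>2) / (1 - C) * g y)"
        using IKint int_g by auto
      fix y
      have r0: "(1 - \<rho>\<^sup>2) / (1 - C) \<ge> 0" using \<rho> C(1) by (auto intro!: divide_nonneg_pos simp: power_le_one)
      show "norm (?I y *\<^sub>R (f y - f x) * of_real (K \<rho> y)) \<le> \<epsilon>' * (?I y * K \<rho> y) + (1 - \<rho>\<^sup>2) / (1 - C) * g y"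
      proof (cases "y \<in> {-P/2..P/2}")
        case True
        show ?thesis
        proof (cases "\<bar>y - x\<bar> < \<eta>")
          case near: True
          have "norm (f y - f x) * K \<rho> y \<le> \<epsilon>' * K \<rho> y"
            using \<eta>(2)[OF near] K0 by (intro mult_right_mono) auto
          moreover have "0 \<le> (1 - \<rho>\<^sup>2) / (1 - C) * g y" using r0 unfolding g_def by (intro mult_nonneg_nonneg norm_ge_zero)
          ultimately show ?thesis using True K0 by (simp add: norm_mult)
        next
          case far: False
          have "K \<rho> y \<le> (1 - \<rho>\<^sup>2) / (1 - C)"
            unfolding K_def by (intro poisson_kernel_le C) (use \<rho> far True in auto)
          then have "norm (f y - f x) * K \<rho> y \<le> norm (f y - f x) * ((1 - \<rho>\<^sup>2) / (1 - C))"
            by (intro mult_left_mono) auto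
          moreover have "0 \<le> \<epsilon>' * K \<rho> y" using K0 \<epsilon>' by simp
          ultimately show ?thesis using True K0 by (simp add: norm_mult g_def mult_ac)
        qed
      qed (simp add: g_def)
    qed (rule integrable_norm[OF Kint[OF int_fx]])
    also have "\<dots> = \<epsilon>' * P + (1 - \<rho>\<^sup>2) / (1 - C) * M"
      using IKint int_g IK by (simp add: M_def)
    also have "\<epsilon>' * P = \<epsilon> / 2" using P by (simp add: \<epsilon>'_def)
    finally show ?thesis .
  qed
  have "((\<lambda>\<rho>. (1 - \<rho>\<^sup>2) / (1 - C) * M) \<longlongrightarrow> (1 - 1\<^sup>2) / (1 - C) * M) (at_left 1)"
    using C(1) by (intro tendsto_intros) auto
  then have "eventually (\<lambda>\<rho>. (1 - \<rho>\<^sup>2) / (1 - C) * M < \<epsilon> / 2) (at_left 1)"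
    using \<epsilon> by (intro order_tendstoD) auto
  moreover have "eventually (\<lambda>\<rho>. \<rho> \<in> {1/2<..<1}) (at_left (1::real))"
    by (rule eventually_at_left_real) auto
  ultimately show "\<forall>\<^sub>F \<rho> in at_left 1.
      dist (LINT y|lborel. f y * of_real (poisson_kernel \<rho> (2 * pi * (x - y) / P))) (of_real P * f x) < \<epsilon>"
  proof eventually_elim
    case (elim \<rho>)
    then have "1/2 < \<rho>" "\<rho> < 1" by auto
    from bound[OF this] elim(1) show ?case unfolding dist_norm K_def by linarith
  qed
qed

text \<open>Abel's limit theorem in the absolutely summable case: by the Weierstrass test the damped
  series is continuous in \<rho> on \<open>{0..1}\<close>, so the undamped series at
  \<open>\<rho> = 1\<close> is the limit of the Poisson integrals.\<close>

lemma fourier_series_at_continuity_point: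
  fixes f :: "real \<Rightarrow> complex"
  assumes P: "P > 0" and f: "integrable lborel f"
    and supp: "\<And>y. f y \<noteq> 0 \<Longrightarrow> \<bar>y\<bar> \<le> P/2"
    and x: "\<bar>x\<bar> < P/2" and cont: "isCont f x"
    and summ: "(\<lambda>k. norm (fourier f (of_int k / P))) summable_on UNIV"
  shows "((\<lambda>k. fourier f (of_int k / P) * cis (2 * pi * k * x / P)) has_sum (of_real P * f x)) UNIV"
proof -
  let ?a = "\<lambda>k. fourier f (of_int k / P)"
  define h where "h k \<rho> = of_real (\<rho> ^ nat \<bar>k\<bar>) * cis (2 * pi * k * x / P) * ?a k" for k :: int and \<rho> :: real
  have h_le: "norm (h k \<rho>) \<le> norm (?a k)" if "\<rho> \<in> {0..1}" for k \<rho>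
    using that by (auto simp: h_def norm_mult norm_power power_le_one intro!: mult_left_le_one_le)
  have "uniform_limit {0..1} (\<lambda>X \<rho>. \<Sum>k\<in>X. h k \<rho>) (\<lambda>\<rho>. \<Sum>\<^sub>\<infinity>k. h k \<rho>) (finite_subsets_at_top UNIV)"
    by (rule Weierstrass_m_test_general[OF h_le summ])
  then have "continuous_on {0..1} (\<lambda>\<rho>. \<Sum>\<^sub>\<infinity>k. h k \<rho>)"
    by (rule uniform_limit_theorem[rotated])
       (auto simp: h_def intro!: always_eventually continuous_intros)
  then have "((\<lambda>\<rho>. \<Sum>\<^sub>\<infinity>k. h k \<rho>) \<longlongrightarrow> (\<Sum>\<^sub>\<infinity>k. h k 1)) (at 1 within {0..1})"
    by (auto simp: continuous_on_def)
  then have lim1: "((\<lambda>\<rho>. \<Sum>\<^sub>\<infinity>k. h k \<rho>) \<longlongrightarrow> (\<Sum>\<^sub>\<infinity>k. h k 1)) (at_left 1)"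
    by (simp add: at_within_Icc_at_left)
  have lim2: "((\<lambda>\<rho>. \<Sum>\<^sub>\<infinity>k. h k \<rho>) \<longlongrightarrow> of_real P * f x) (at_left 1)"
  proof (rule Lim_transform_eventually[OF poisson_integral_tendsto[OF P f supp x cont]])
    have "eventually (\<lambda>\<rho>. \<rho> \<in> {0<..<1}) (at_left (1::real))"
      by (rule eventually_at_left_real) auto
    then show "\<forall>\<^sub>F \<rho> in at_left 1.
        (LINT y|lborel. f y * of_real (poisson_kernel \<rho> (2 * pi * (x - y) / P))) = (\<Sum>\<^sub>\<infinity>k. h k \<rho>)"
    proof eventually_elim
      case (elim \<rho>)
      then show ?case
        using has_sum_poisson_fourier[OF f, of \<rho> x P] unfolding h_def by (intro infsumI[symmetric]) auto
    qed
  qed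
  have "(\<Sum>\<^sub>\<infinity>k. h k 1) = of_real P * f x"
    by (rule tendsto_unique[OF _ lim1 lim2]) simp
  moreover have "(\<lambda>k. h k 1) summable_on UNIV"
    by (rule abs_summable_summable[OF Infinite_Sum.abs_summable_on_comparison_test'[OF summ]]) (rule h_le, simp)
  ultimately have "((\<lambda>k. h k 1) has_sum (of_real P * f x)) UNIV"
    using has_sum_infsum by metis
  then show ?thesis by (simp add: h_def mult.commute)
qed

section \<open>Absolute summability of equally spaced samples\<close>

lemma sum_lessThan_double: "(\<Sum>i<2 * m. F i) = (\<Sum>j<m. F (2 * j) + F (Suc (2 * j)))"
  for F :: "nat \<Rightarrow> 'a :: comm_monoid_add"
  by (induction m) (auto simp: add_ac)

lemma sum_indicator_consecutive:
  fixes c :: "nat \<Rightarrow> real"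
  assumes "incseq c"
  shows "(\<Sum>j<m. indicator {c j..<c (Suc j)} u) = (indicator {c 0..<c m} u :: real)"
proof (induction m)
  case (Suc m)
  have "c 0 \<le> c m" "c m \<le> c (Suc m)" using assms by (auto simp: incseq_def)
  then show ?case by (auto simp: Suc.IH split: split_indicator)
qed simp

text \<open>Replacing each sample by the value at distance \<open>y\<close> to its right, with
  \<open>0 \<le> y \<le> h\<close>, costs at most the variation bound \<open>B\<close> in total.
  Averaging over \<open>y\<close> turns the shifted values into integrals over disjoint intervals of
  length \<open>h\<close>, together at most the L1 norm.\<close>

lemma sum_norm_samples_le:
  fixes f :: "real \<Rightarrow> complex" and a h B :: real and m :: nat
  assumes f: "integrable lborel f" and h: "h > 0"
    and B: "\<And>x n. incseq x \<Longrightarrow> (\<Sum>i<n. norm (f (x (Suc i)) - f (x i))) \<le> B"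
  shows "(\<Sum>j<m. norm (f (a + j * h))) \<le> B + (LINT y|lborel. norm (f y)) / h"
proof -
  define A where "A = (\<Sum>j<m. norm (f (a + j * h)))"
  have pointwise: "A \<le> B + (\<Sum>j<m. norm (f (a + j * h + y)))" if y: "0 \<le> y" "y \<le> h" for y
  proof -
    \<comment> \<open>Sample points and shifted points alternate. The steps leaving an even index
      compare a sample with its shift; those leaving an odd index only enlarge the variation
      sum.\<close>
    define x :: "nat \<Rightarrow> real" where "x i = a + real (i div 2) * h + (if even i then 0 else y)" for i
    have "incseq x"
    proof (rule incseq_SucI)
      show "x i \<le> x (Suc i)" for i
      proof (cases "even i")
        case False
        then have "Suc i div 2 = Suc (i div 2)" by presburger
        then show ?thesis using y False by (simp add: x_def algebra_simps)
      qed (use y in \<open>simp add: x_def\<close>)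
    qed
    then have "(\<Sum>i<2 * m. norm (f (x (Suc i)) - f (x i))) \<le> B" by (rule B)
    moreover have "(\<Sum>j<m. norm (f (x (Suc (2 * j))) - f (x (2 * j))))
        \<le> (\<Sum>i<2 * m. norm (f (x (Suc i)) - f (x i)))"
      unfolding sum_lessThan_double by (intro sum_mono) simp
    moreover have "A \<le> (\<Sum>j<m. norm (f (x (Suc (2 * j))) - f (x (2 * j))) + norm (f (a + j * h + y)))"
      unfolding A_def
    proof (rule sum_mono)
      fix j
      have "x (2 * j) = a + j * h" "x (Suc (2 * j)) = a + j * h + y" by (auto simp: x_def)
      then show "norm (f (a + j * h)) \<le> norm (f (x (Suc (2 * j))) - f (x (2 * j))) + norm (f (a + j * h + y))"
        using norm_triangle_ineq3[of "f (a + j * h)" "f (a + j * h + y)"]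
        by (simp add: norm_minus_commute)
    qed
    ultimately show ?thesis by (simp add: sum.distrib)
  qed
  \<comment> \<open>Half-open intervals make the translates pairwise disjoint, so that their
    indicators sum to at most 1 at every point.\<close>
  let ?I = "indicator {0..<h} :: real \<Rightarrow> real"
  let ?J = "\<lambda>j. indicator {a + real j * h..<a + real (Suc j) * h} :: real \<Rightarrow> real"
  have intI: "integrable lborel ?I"
    by (rule integrable_real_indicator) (use h in auto)
  have int_shift: "integrable lborel (\<lambda>y. f (c + y))" for c
    using lborel_integrable_real_affine[OF f, of 1 c] by simp
  have int_sh: "integrable lborel (\<lambda>y. ?I y * norm (f (c + y)))" for c
    by (rule Bochner_Integration.integrable_bound[OF int_shift[of c]])
       (use int_shift[of c] in \<open>auto split: split_indicator\<close>)
  have int_J: "integrable lborel (\<lambda>u. ?J j u * norm (f u))" for j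
    by (rule Bochner_Integration.integrable_bound[OF f])
       (use f in \<open>auto split: split_indicator\<close>)
  have "h * A = (LINT y|lborel. ?I y * A)" using h by simp
  also have "\<dots> \<le> (LINT y|lborel. ?I y * B + (\<Sum>j<m. ?I y * norm (f (a + j * h + y))))"
  proof (rule integral_mono)
    show "?I y * A \<le> ?I y * B + (\<Sum>j<m. ?I y * norm (f (a + j * h + y)))" for y
      using pointwise[of y] by (cases "y \<in> {0..<h}") simp_all
  qed (intro Bochner_Integration.integrable_add Bochner_Integration.integrable_sum
         integrable_mult_left intI int_sh)+
  also have "\<dots> = (LINT y|lborel. ?I y * B) + (LINT y|lborel. (\<Sum>j<m. ?I y * norm (f (a + j * h + y))))"
    by (intro Bochner_Integration.integral_add Bochner_Integration.integrable_sum
          integrable_mult_left intI int_sh)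
  also have "(LINT y|lborel. ?I y * B) = h * B" using h by simp
  also have "(LINT y|lborel. (\<Sum>j<m. ?I y * norm (f (a + j * h + y))))
      = (\<Sum>j<m. LINT y|lborel. ?I y * norm (f (a + j * h + y)))"
    by (rule Bochner_Integration.integral_sum) (rule int_sh)
  also have "(\<Sum>j<m. LINT y|lborel. ?I y * norm (f (a + j * h + y))) = (\<Sum>j<m. LINT u|lborel. ?J j u * norm (f u))"
  proof (rule sum.cong[OF refl])
    fix j
    have "(LINT u|lborel. ?J j u * norm (f u))
        = (LINT y|lborel. ?J j (a + j * h + y) * norm (f (a + j * h + y)))"
      using lborel_integral_real_affine[of 1 "\<lambda>u. ?J j u * norm (f u)" "a + j * h"] by simp
    also have "(\<lambda>y. ?J j (a + j * h + y)) = ?I"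
      by (auto simp: fun_eq_iff algebra_simps split: split_indicator)
    finally show "(LINT y|lborel. ?I y * norm (f (a + j * h + y))) = (LINT u|lborel. ?J j u * norm (f u))"
      by (metis (no_types, lifting) Bochner_Integration.integral_cong)
  qed
  also have "\<dots> = (LINT u|lborel. (\<Sum>j<m. ?J j u * norm (f u)))"
    by (rule Bochner_Integration.integral_sum[symmetric]) (rule int_J)
  also have "\<dots> \<le> (LINT u|lborel. norm (f u))"
  proof (rule integral_mono)
    have "incseq (\<lambda>j. a + real j * h)"
      using h by (auto simp: incseq_def intro!: mult_right_mono)
    note eq = sum_indicator_consecutive[OF this]
    have "(\<Sum>j<m. ?J j u) \<le> 1" for u by (subst eq) (auto split: split_indicator)
    then show "(\<Sum>j<m. ?J j u * norm (f u)) \<le> norm (f u)" for u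
      unfolding sum_distrib_right[symmetric]
      using mult_right_mono[of "\<Sum>j<m. ?J j u" 1 "norm (f u)"] by simp
  qed (intro Bochner_Integration.integrable_sum int_J integrable_norm f)+
  finally show ?thesis
    using h by (simp add: A_def field_simps)
qed

text \<open>The preceding bound depends neither on the starting point nor on the number of samples,
  so it bounds all finite sums at once: each lies inside a symmetric range of indices.\<close>

lemma summable_on_norm_samples:
  fixes f :: "real \<Rightarrow> complex"
  assumes f: "integrable lborel f" and bv: "bounded_variation f" and h: "h > 0"
  shows "(\<lambda>k::int. norm (f (k * h))) summable_on UNIV"
proof -
  obtain B where B: "\<And>x n. incseq x \<Longrightarrow> (\<Sum>i<n. norm (f (x (Suc i)) - f (x i))) \<le> B"
    using bv unfolding bounded_variation_def by blast
  show ?thesis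
  proof (rule nonneg_bdd_above_summable_on)
    show "bdd_above (sum (\<lambda>k::int. norm (f (k * h))) ` {F. F \<subseteq> UNIV \<and> finite F})"
    proof (rule bdd_aboveI2)
      fix F :: "int set" assume F: "F \<in> {F. F \<subseteq> UNIV \<and> finite F}"
      \<comment> \<open>Inserting \<open>0\<close> covers the empty set, and the successor gives the
        strict bound wanted for the half-open range.\<close>
      define n where "n = Suc (nat (Max (insert 0 (abs ` F))))"
      have n: "\<bar>k\<bar> < int n" if "k \<in> F" for k
      proof -
        have "\<bar>k\<bar> \<le> Max (insert 0 (abs ` F))" using F that by (intro Max_ge) auto
        moreover have "\<bar>k\<bar> \<ge> 0" by simp
        ultimately show ?thesis unfolding n_def by linarith
      qed
      have "(\<Sum>k\<in>F. norm (f (k * h))) \<le> (\<Sum>k\<in>{-int n..<int n}. norm (f (k * h)))"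
        by (rule sum_mono2) (use n in force)+
      also have "\<dots> = (\<Sum>j<2 * n. norm (f (- (n * h) + j * h)))"
        by (rule sum.reindex_bij_witness[of _ "\<lambda>j. int j - int n" "\<lambda>k. nat (k + int n)"])
           (auto simp: algebra_simps)
      also have "\<dots> \<le> B + (LINT y|lborel. norm (f y)) / h"
        by (rule sum_norm_samples_le[OF f h B])
      finally show "(\<Sum>k\<in>F. norm (f (k * h))) \<le> B + (LINT y|lborel. norm (f y)) / h" .
    qed
  qed simp
qed

section \<open>The tent function and its Fourier coefficients\<close>

definition tent :: "real \<Rightarrow> complex" where
  "tent y = indicator {-1..1} y *\<^sub>R of_real (1/2 - \<bar>y\<bar>)"

lemma tent_minus: "tent (- y) = tent y"
  by (auto simp: tent_def split: split_indicator)

lemma tent_nonzero: "tent y \<noteq> 0 \<Longrightarrow> \<bar>y\<bar> \<le> 1"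
  by (auto simp: tent_def split: split_indicator_asm)

lemma integrable_tent: "integrable lborel tent"
  unfolding tent_def
  by (rule borel_integrable_compact) (auto intro!: continuous_intros)

lemma isCont_tent:
  assumes "\<bar>x\<bar> < 1"
  shows "isCont tent x"
proof -
  have "continuous_on {-1<..<1} (\<lambda>y. complex_of_real (1/2 - \<bar>y\<bar>))"
    by (intro continuous_intros)
  then have "continuous_on {-1<..<1} tent"
    by (subst continuous_on_cong[OF refl, of _ _ "\<lambda>y. complex_of_real (1/2 - \<bar>y\<bar>)"])
       (auto simp: tent_def)
  then show ?thesis using assms by (auto simp: continuous_on_eq_continuous_at abs_less_iff)
qed

text \<open>Integrating both halves explicitly, the terms in \<open>1 / c\<close> cancel and
  \<open>2 * (exp c - 1) / c\<^sup>2\<close> remains for \<open>k \<noteq> 0\<close>; it vanishes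
  for even \<open>k\<close>. At \<open>k = 0\<close> the tent has integral zero.\<close>

lemma fourier_tent:
  "fourier tent (of_int k / 2) = (if odd k then of_real (4 / (pi\<^sup>2 * (of_int k)\<^sup>2)) else 0)"
proof -
  define c :: complex where "c = - (of_real pi * \<i> * of_int k)"
  have c: "c = 0 \<longleftrightarrow> k = 0" by (auto simp: c_def)
  \<comment> \<open>On either side of the origin \<open>\<bar>y\<bar> = \<sigma> * y\<close>, with
    \<sigma> equal to 1 on the right and -1 on the left. The case \<open>k = 0\<close> is apart
    because \<open>c\<close> vanishes.\<close>
  define F where "F \<sigma> z = (if k = 0 then z / 2 - \<sigma> * z\<^sup>2 / 2
    else (1/2 - \<sigma> * z) * exp (c * z) / c + \<sigma> * exp (c * z) / c\<^sup>2)" for \<sigma> z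
  let ?g = "\<lambda>\<sigma> y. (1/2 - \<sigma> * of_real y) * exp (c * of_real y)"
  have deriv: "((\<lambda>y. F \<sigma> (of_real y)) has_vector_derivative ?g \<sigma> y) (at y within A)" for \<sigma> y A
  proof (rule has_vector_derivative_real_field)
    show "(F \<sigma> has_field_derivative ?g \<sigma> y) (at (of_real y))"
      unfolding F_def using c
      by (cases "k = 0") (auto intro!: derivative_eq_intros simp: field_simps power2_eq_square)
  qed
  have cont: "continuous_on A (?g \<sigma>)" for \<sigma> A by (intro continuous_intros)
  have ftc: "has_bochner_integral lborel (\<lambda>y. indicator {a..b} y *\<^sub>R ?g \<sigma> y) (F \<sigma> (of_real b) - F \<sigma> (of_real a))"
    if "a \<le> b" for a b \<sigma>
    using that by (rule has_bochner_integral_FTC_Icc[OF _ deriv cont])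
  have "fourier tent (of_int k / 2) = (LINT y|lborel. tent y * exp (c * of_real y))"
    unfolding fourier_cis cis_eq_exp by (simp add: c_def mult_ac)
  \<comment> \<open>The two closed halves share the point 0, so this equality is claimed only almost
    everywhere.\<close>
  also have "\<dots> = (LINT y|lborel. indicator {0..1} y *\<^sub>R ?g 1 y + indicator {-1..0} y *\<^sub>R ?g (-1) y)"
  proof (rule integral_cong_AE)
    show "(\<lambda>y. tent y * exp (c * of_real y)) \<in> borel_measurable lborel"
      using integrable_tent by measurable
    show "AE y in lborel. tent y * exp (c * of_real y)
        = indicator {0..1} y *\<^sub>R ?g 1 y + indicator {-1..0} y *\<^sub>R ?g (-1) y"
      using AE_lborel_singleton[of 0]
      by eventually_elim (auto simp: tent_def split: split_indicator)
  qed measurable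
  also have "\<dots> = (F 1 1 - F 1 0) + (F (-1) 0 - F (-1) (-1))"
    using has_bochner_integral_add[OF ftc[of 0 1 1] ftc[of "-1" 0 "-1"]]
    by (simp add: has_bochner_integral_iff)
  also have "\<dots> = (if odd k then of_real (4 / (pi\<^sup>2 * (of_int k)\<^sup>2)) else 0)"
  proof (cases "k = 0")
    case False
    have e: "exp c = (if even k then 1 else -1)" "exp (- c) = (if even k then 1 else -1)"
      unfolding c_def minus_minus by (rule exp_minus_pi_int exp_pi_int)+
    have c2: "c\<^sup>2 = - of_real (pi\<^sup>2 * (of_int k)\<^sup>2)" by (simp add: c_def power_mult_distrib)
    have "(F 1 1 - F 1 0) + (F (-1) 0 - F (-1) (-1)) = (if odd k then - 4 / c\<^sup>2 else 0)"
      using False c by (simp add: F_def e field_simps power2_eq_square)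
    also have "\<dots> = (if odd k then of_real (4 / (pi\<^sup>2 * (of_int k)\<^sup>2)) else 0)"
      unfolding c2 by simp
    finally show ?thesis .
  qed (simp add: F_def)
  finally show ?thesis .
qed

lemma summable_on_inverse_square_int: "(\<lambda>k::int. 1 / (real_of_int k)\<^sup>2) summable_on UNIV"
proof -
  \<comment> \<open>The index 0 contributes \<open>1 / 0 = 0\<close>.\<close>
  have s: "(\<lambda>n. 1 / (real n)\<^sup>2) summable_on UNIV"
    using inverse_power_summable[of 2, where 'a = real]
    by (subst summable_on_UNIV_nonneg_real_iff) (auto simp: inverse_eq_divide)
  have s': "(\<lambda>n. 1 / (real (Suc n))\<^sup>2) summable_on UNIV"
    using inverse_power_summable[of 2, where 'a = real]
    by (subst summable_on_UNIV_nonneg_real_iff, simp, subst summable_Suc_iff) (auto simp: inverse_eq_divide)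
  have "(\<lambda>k::int. 1 / (real_of_int k)\<^sup>2) summable_on range int"
    using s by (subst summable_on_reindex) (auto simp: o_def)
  moreover have "(\<lambda>k::int. 1 / (real_of_int k)\<^sup>2) summable_on range (\<lambda>n. - int (Suc n))"
  proof (subst summable_on_reindex)
    show "((\<lambda>k::int. 1 / (real_of_int k)\<^sup>2) \<circ> (\<lambda>n. - int (Suc n))) summable_on UNIV"
      using s' by (simp add: o_def power2_eq_square algebra_simps)
  qed (auto simp: inj_on_def)
  ultimately show ?thesis
    unfolding UNIV_int_split by (intro summable_on_Un_disjoint) auto
qed

lemma summable_on_fourier_tent: "(\<lambda>k. norm (fourier tent (of_int k / 2))) summable_on UNIV"
proof (rule Infinite_Sum.abs_summable_on_comparison_test')
  show "(\<lambda>k::int. 4 / pi\<^sup>2 * (1 / (real_of_int k)\<^sup>2)) summable_on UNIV"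
    by (intro summable_on_cmult_right summable_on_inverse_square_int)
  show "norm (fourier tent (of_int k / 2)) \<le> 4 / pi\<^sup>2 * (1 / (real_of_int k)\<^sup>2)" for k
    unfolding fourier_tent by (auto simp: norm_divide norm_mult norm_power)
qed

text \<open>The tent coefficients serve as weights. By the sign in the transform the weighted series
  is the period-2 Fourier series of the tent at \<open>- y\<close>, hence \<open>2 * tent y\<close>
  by evenness. It is evaluated for \<open>\<bar>y\<bar> < 1\<close>; the points 1 and -1 form a null
  set, and beyond them \<open>r\<close> vanishes.\<close>

lemma has_sum_fourier_tent:
  assumes r: "integrable lborel r" and supp: "\<And>y. r y \<noteq> 0 \<Longrightarrow> \<bar>y\<bar> \<le> 1"
  shows "((\<lambda>k. fourier tent (of_int k / 2) * fourier r (of_int k / 2)) has_sum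
           (LINT y|lborel. r y * (2 * tent y))) UNIV"
proof (rule has_sum_fourier[OF r summable_on_fourier_tent])
  show "(\<lambda>y. 2 * tent y) \<in> borel_measurable lborel" using integrable_tent by measurable
  show "AE y in lborel. r y \<noteq> 0 \<longrightarrow> ((\<lambda>k. fourier tent (of_int k / 2) *
      cis (- 2 * pi * (of_int k / 2) * y)) has_sum 2 * tent y) UNIV"
    using AE_lborel_singleton[of 1] AE_lborel_singleton[of "-1"]
  proof eventually_elim
    case (elim y)
    show ?case
    proof
      assume "r y \<noteq> 0"
      then have y: "\<bar>- y\<bar> < 1" using elim supp[of y] by auto
      show "((\<lambda>k. fourier tent (of_int k / 2) *
          cis (- 2 * pi * (of_int k / 2) * y)) has_sum 2 * tent y) UNIV"
        using fourier_series_at_continuity_point[of 2 tent "- y", OF _ integrable_tent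
            _ _ isCont_tent[OF y] summable_on_fourier_tent] y tent_nonzero
        by (simp add: tent_minus mult_ac)
    qed
  qed
qed

section \<open>Poisson summation at the half-integers\<close>

lemma absolutely_summable_trigonometric_series:
  assumes "(\<lambda>k::int. norm (a k)) summable_on UNIV"
  shows "((\<lambda>k. a k * cis (2 * pi * k * x / P)) has_sum (\<Sum>\<^sub>\<infinity>k. a k * cis (2 * pi * k * x / P))) UNIV"
    and "continuous_on UNIV (\<lambda>x. \<Sum>\<^sub>\<infinity>k. a k * cis (2 * pi * k * x / P))"
proof -
  define g where "g k y = a k * cis (2 * pi * of_int k * y / P)" for k y
  have le: "norm (g k y) \<le> norm (a k)" for k y by (simp add: g_def norm_mult)
  have "(\<lambda>k. norm (g k x)) summable_on UNIV"
    by (rule Infinite_Sum.abs_summable_on_comparison_test'[OF assms]) (rule le)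
  then show "((\<lambda>k. a k * cis (2 * pi * k * x / P)) has_sum (\<Sum>\<^sub>\<infinity>k. a k * cis (2 * pi * k * x / P))) UNIV"
    unfolding g_def by (rule has_sum_infsum[OF abs_summable_summable])
  have cont: "continuous_on UNIV (g k)" for k
    unfolding g_def divide_inverse by (intro continuous_intros)
  have "uniform_limit UNIV (\<lambda>X y. \<Sum>k\<in>X. g k y) (\<lambda>y. \<Sum>\<^sub>\<infinity>k. g k y) (finite_subsets_at_top UNIV)"
    by (rule Weierstrass_m_test_general[OF _ assms]) (rule le)
  then have "continuous_on UNIV (\<lambda>y. \<Sum>\<^sub>\<infinity>k. g k y)"
    by (rule uniform_limit_theorem[rotated])
       (auto intro!: always_eventually continuous_on_sum cont)
  then show "continuous_on UNIV (\<lambda>x. \<Sum>\<^sub>\<infinity>k. a k * cis (2 * pi * k * x / P))"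
    unfolding g_def .
qed

text \<open>A shift by half the period multiplies the term of index \<open>k\<close> by
  \<open>(-1)^k\<close>, so averaging over \<open>x\<close> and \<open>x + 2\<close> keeps exactly
  the even indices.\<close>

lemma has_sum_even_indices:
  fixes a :: "int \<Rightarrow> complex"
  assumes S: "\<And>x. ((\<lambda>k. a k * cis (2 * pi * k * x / 4)) has_sum S x) UNIV"
  shows "((\<lambda>k. a (2 * k) * cis (pi * k * x)) has_sum ((S x + S (x + 2)) / 2)) UNIV"
proof -
  have cis_shift: "cis (2 * pi * k * (x + 2) / 4) = cis (2 * pi * k * x / 4) * (if even k then 1 else -1)" for k
  proof -
    have "2 * pi * k * (x + 2) / 4 = 2 * pi * k * x / 4 + pi * k" by (simp add: algebra_simps)
    then show ?thesis by (simp only: cis_mult[symmetric] cis_pi_int)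
  qed
  let ?h = "\<lambda>k. (a k * cis (2 * pi * k * x / 4) + a k * cis (2 * pi * k * (x + 2) / 4)) / 2"
  have h: "?h k = (if even k then a k * cis (2 * pi * k * x / 4) else 0)" for k
    unfolding cis_shift by simp
  have "(?h has_sum ((S x + S (x + 2)) / 2)) UNIV"
    unfolding divide_inverse by (intro has_sum_cmult_left has_sum_add S[unfolded divide_inverse])
  also have "(?h has_sum ((S x + S (x + 2)) / 2)) UNIV \<longleftrightarrow>
      (?h has_sum ((S x + S (x + 2)) / 2)) (range ((*) 2))"
    by (rule has_sum_cong_neutral) (auto simp only: h split: if_splits)
  also have "\<dots> \<longleftrightarrow> ((?h \<circ> (*) 2) has_sum ((S x + S (x + 2)) / 2)) UNIV"
    by (rule has_sum_reindex) (auto simp: inj_on_def)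
  also have "?h \<circ> (*) 2 = (\<lambda>k. a (2 * k) * cis (pi * k * x))"
  proof
    fix k :: int
    have "2 * pi * real_of_int (2 * k) * x / 4 = pi * k * x" by simp
    then show "(?h \<circ> (*) 2) k = a (2 * k) * cis (pi * k * x)"
      unfolding o_def h by (simp add: mult.assoc)
  qed
  finally show ?thesis .
qed

text \<open>The series \<open>S\<close> with coefficients at the quarter-integers has period 4, and
  its even indices are the half-integers. Averaging at \<open>x = 0\<close> gives
  \<open>(S 0 + S 2) / 2 = 2 * r 0\<close>, and at \<open>x = -1\<close> it gives
  \<open>(S (-1) + S 1) / 2 = 0\<close>, the signs coming from
  \<open>cis (- pi * k)\<close>.\<close>

lemma poisson_sums_half_integers:
  fixes r :: "real \<Rightarrow> complex"
  assumes r: "integrable lborel r" and R: "integrable lborel (fourier r)" "bounded_variation (fourier r)"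
    and supp: "\<And>y. r y \<noteq> 0 \<Longrightarrow> \<bar>y\<bar> \<le> 1" and cont: "isCont r 0"
  shows "((\<lambda>k. fourier r (of_int k / 2)) has_sum (2 * r 0)) UNIV"
    and "((\<lambda>k. fourier r (of_int k / 2) * cis (pi * of_int k)) has_sum 0) UNIV"
proof -
  define a where "a k = fourier r (of_int k / 4)" for k :: int
  have summ: "(\<lambda>k. norm (a k)) summable_on UNIV"
    using summable_on_norm_samples[OF R, of "1/4"] by (simp add: a_def)
  define S where "S x = (\<Sum>\<^sub>\<infinity>k. a k * cis (2 * pi * k * x / 4))" for x :: real
  have S: "((\<lambda>k. a k * cis (2 * pi * k * x / 4)) has_sum S x) UNIV" for x
    unfolding S_def by (rule absolutely_summable_trigonometric_series(1)[OF summ])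
  have contS: "continuous_on UNIV S"
    unfolding S_def by (rule absolutely_summable_trigonometric_series(2)[OF summ])
  have S_eq: "S x = 4 * r x" if "\<bar>x\<bar> < 2" "isCont r x" for x
  proof -
    have "((\<lambda>k. a k * cis (2 * pi * k * x / 4)) has_sum of_real 4 * r x) UNIV"
      unfolding a_def
    proof (rule fourier_series_at_continuity_point[OF _ r _ _ that(2)])
      show "(\<lambda>k. norm (fourier r (of_int k / 4))) summable_on UNIV"
        using summ unfolding a_def .
      show "\<bar>y\<bar> \<le> 4 / 2" if "r y \<noteq> 0" for y using supp[OF that] by simp
    qed (use that(1) in simp_all)
    from has_sum_unique[OF S this] show ?thesis by simp
  qed
  txt \<open>
    Continuity of \<open>S\<close> yields its values at \<open>\<plusminus>1\<close>, where \<open>r\<close> itself need not be continuous and may be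
    nonzero. This is why the period is \<open>4\<close> rather than \<open>2\<close>.
  \<close>
  have S_zero: "S x = 0" if "1 < \<bar>x\<bar>" "\<bar>x\<bar> < 2" for x
  proof -
    have "open {y::real. 1 < \<bar>y\<bar>}" by (intro open_Collect_less continuous_intros)
    then have "eventually (\<lambda>y. y \<in> {y::real. 1 < \<bar>y\<bar>}) (nhds x)"
      using that by (intro eventually_nhds_in_open) auto
    then have "eventually (\<lambda>y. r y = 0) (nhds x)"
    proof eventually_elim
      case (elim y)
      then show ?case using supp[of y] by fastforce
    qed
    then have "isCont r x \<longleftrightarrow> isCont (\<lambda>_. 0 :: complex) x" by (rule isCont_cong)
    then have "isCont r x" by simp
    moreover have "r x = 0" using supp[of x] that by fastforce
    ultimately show ?thesis using S_eq[of x] that by simp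
  qed
  have S_closed: "S x = 0" if "x \<in> closure {a<..<b}" "\<And>y. y \<in> {a<..<b} \<Longrightarrow> S y = 0" for x a b
    by (rule continuous_constant_on_closure[OF continuous_on_subset[OF contS subset_UNIV] that(2,1)])
  have "S 1 = 0" "S 2 = 0" "S (-1) = 0"
    using S_closed[of 1 1 2] S_closed[of 2 1 2] S_closed[of "-1" "-2" "-1"] by (simp_all add: S_zero)
  note S_ends = this
  have a2: "a (2 * k) = fourier r (of_int k / 2)" for k by (simp add: a_def)
  show "((\<lambda>k. fourier r (of_int k / 2)) has_sum (2 * r 0)) UNIV"
  proof -
    \<comment> \<open>Continuity of \<open>r\<close> at 0 enters here, tying the sum of the series
      to the value \<open>r 0\<close>.\<close>
    have "S 0 = 4 * r 0" using cont by (intro S_eq) auto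
    with has_sum_even_indices[OF S, of 0] show ?thesis by (simp add: a2 S_ends)
  qed
  have "cis (pi * of_int k * (-1)) = cis (pi * of_int k)" for k
    by (auto simp: complex_eq_iff sin_npi_int)
  with has_sum_even_indices[OF S, of "-1"]
  show "((\<lambda>k. fourier r (of_int k / 2) * cis (pi * of_int k)) has_sum 0) UNIV"
    by (simp add: a2 S_ends)
qed

lemma integral_tent:
  fixes r :: "real \<Rightarrow> complex"
  assumes r: "integrable lborel r" and even: "\<And>y. r (- y) = r y"
    and supp: "\<And>y. r y \<noteq> 0 \<Longrightarrow> \<bar>y\<bar> \<le> 1"
  shows "(LINT y|lborel. r y * (2 * tent y)) =
           fourier r 0 - 4 * (LINT y:{0..1}|lborel. of_real y * r y)"
proof -
  \<comment> \<open>Half of \<open>\<bar>y\<bar> * r y\<close>. By evenness its reflection supplies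
    the other half with the same integral; with the weight \<open>1 - 2 * \<bar>y\<bar>\<close> this
    produces the factor 4.\<close>
  define q where "q y = indicator {0..1} y *\<^sub>R (of_real y * r y)" for y
  have q: "integrable lborel q"
    by (rule Bochner_Integration.integrable_bound[OF r])
       (use r in \<open>auto simp: q_def[abs_def] norm_mult mult_left_le_one_le split: split_indicator\<close>)
  have q': "integrable lborel (\<lambda>y. q (- y))"
    using lborel_integrable_real_affine[OF q, of "-1" 0] by simp
  have q_refl: "(LINT y|lborel. q (- y)) = (LINT y|lborel. q y)"
    using lborel_integral_real_affine[of "-1" q 0] by simp
  have eq: "r y * (2 * tent y) = r y - 2 * (q y + q (- y))" for y
  proof (cases "r y = 0")
    case True
    then show ?thesis by (simp add: q_def even)
  next
    case False
    have t: "tent y = of_real (1/2 - \<bar>y\<bar>)" using supp[OF False] by (simp add: tent_def indicator_def abs_le_iff)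
    \<comment> \<open>At \<open>y = 0\<close> both indicators are 1, but the factor \<open>y\<close>
      vanishes, so the identity holds there too.\<close>
    have qq: "q y + q (- y) = of_real \<bar>y\<bar> * r y"
      using supp[OF False] by (cases y "0 :: real" rule: linorder_cases) (simp_all add: q_def even)
    show ?thesis unfolding t qq by (simp add: algebra_simps)
  qed
  have "(LINT y|lborel. r y * (2 * tent y)) = (LINT y|lborel. r y) - 2 * (2 * (LINT y|lborel. q y))"
    unfolding eq using r q q' by (simp add: q_refl)
  then show ?thesis by (simp add: fourier_cis q_def set_lebesgue_integral_def)
qed

section \<open>Combination of the summation formulas with the densities\<close>

theorem theorem4:
  fixes r :: "real \<Rightarrow> complex" and \<delta> :: real
  assumes "0 < \<delta>" and "\<delta> \<le> 1/2"
    and "integrable lborel r" and "\<And>\<alpha>. r (- \<alpha>) = r \<alpha>" and "bounded_variation r"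
    and "integrable lborel (fourier r)" and "\<And>t. fourier r (- t) = fourier r t"
    and "bounded_variation (fourier r)"
    and "\<And>\<alpha>. r \<alpha> \<noteq> 0 \<Longrightarrow> \<bar>\<alpha>\<bar> \<le> 1"
    and "isCont r 0"
    and "AH_density \<delta>"
  shows "((\<lambda>k::int. fourier r (real_of_int k / 2) * of_real (AH_p \<delta> k)) has_sum
           (r 0 + 2 * (LINT \<alpha>:{0..1}|lborel. of_real \<alpha> * r \<alpha>))) UNIV"
proof -
  note r = assms(3) and supp = assms(9)
  define p where "p = AH_p \<delta> 0"
  define R where "R k = fourier r (real_of_int k / 2)" for k :: int
  define I where "I = (LINT \<alpha>:{0..1}|lborel. of_real \<alpha> * r \<alpha>)"
  note sums = poisson_sums_half_integers[OF r assms(6,8) supp assms(10), folded R_def]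
  have tri: "((\<lambda>k. fourier tent (of_int k / 2) * R k) has_sum (R 0 - 4 * I)) UNIV"
    using has_sum_fourier_tent[OF r supp] integral_tent[OF r assms(4) supp]
    by (simp add: R_def I_def)
  \<comment> \<open>Half of this \<open>R 0\<close> cancels the \<open>R 0\<close> brought in by the
    tent sum, whose coefficient is \<open>- 1/2\<close>.\<close>
  have zero: "((\<lambda>k. of_bool (k = 0) * R k) has_sum R 0) UNIV"
    by (rule has_sum_finite_neutralI[of "{0}"]) auto
  \<comment> \<open>The tent coefficients are twice the correction \<open>2 / (pi^2 k^2)\<close>,
    hence the factor \<open>- 1/2\<close>. The parameter \<open>p\<close> multiplies only the
    alternating sum, which is zero.\<close>
  have term_eq: "R k * of_real (AH_p \<delta> k) =
      1/2 * R k + of_real (p - 1) * (R k * cis (pi * k)) + 1/2 * (of_bool (k = 0) * R k)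
        + (- 1/2) * (fourier tent (of_int k / 2) * R k)" for k
  proof -
    define \<sigma> :: real where "\<sigma> = (if even k then 1 else -1)"
    define t :: real where "t = (if odd k then 4 / (pi\<^sup>2 * (of_int k)\<^sup>2) else 0)"
    have c: "cis (pi * k) = of_real \<sigma>"
      by (simp add: \<sigma>_def cis_pi_int)
    have f: "fourier tent (of_int k / 2) = of_real t"
      by (simp add: fourier_tent t_def)
    have AH: "AH_p \<delta> k = 1/2 + (p - 1) * \<sigma> + 1/2 * of_bool (k = 0) + (- 1/2) * t"
      using assms(11) by (auto simp: AH_density_def p_def \<sigma>_def t_def)
    show ?thesis unfolding c f AH by (cases "k = 0") (simp_all add: algebra_simps)
  qed
  have "((\<lambda>k. R k * of_real (AH_p \<delta> k)) has_sum
      (1/2 * (2 * r 0) + of_real (p - 1) * 0 + 1/2 * R 0 + (- 1/2) * (R 0 - 4 * I))) UNIV"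
    unfolding term_eq
    by (rule has_sum_add[OF has_sum_add[OF has_sum_add[OF
          has_sum_cmult_right[OF sums(1)] has_sum_cmult_right[OF sums(2)]]
          has_sum_cmult_right[OF zero]] has_sum_cmult_right[OF tri]])
  also have "1/2 * (2 * r 0) + of_real (p - 1) * 0 + 1/2 * R 0 + (- 1/2) * (R 0 - 4 * I) = r 0 + 2 * I"
    by (simp add: field_simps)
  finally show ?thesis unfolding R_def I_def .
qed

end
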